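(* For every $q\in(0,1)$, every complex conjugate pair of (non-real) zeros of $\theta(q,\cdot)$ with non-negative real part (if any) belongs to the half-annulus $\mathcal{A}:=\{x\in\mathbb{C} : \mathrm{Re}\,x\geq 0,\ 1<|x|<5\}$.
   Context: The partial theta function is $\theta(q,x):=\sum_{j=0}^{\infty}q^{j(j+1)/2}x^j$, where $q\in(0,1)$ is a parameter and $x\in\mathbb{C}$ is the variable. For each fixed $q\in(0,1)$ it is an entire function of $x$ with real coefficients, so its non-real zeros come in complex conjugate pairs. *)

theory Defs
  imports "HOL-Analysis.Analysis"
begin

definition partial_theta :: "real \<Rightarrow> complex \<Rightarrow> complex" where
  "partial_theta q x = (\<Sum>j. of_real q ^ (j * (j + 1) div 2) * x ^ j)"

(* The series converges for every x, so suminf is its actual sum. *)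
lemma summable_partial_theta:
  fixes q :: real and x :: complex
  assumes "0 < q" "q < 1"
  shows "summable (\<lambda>j. of_real q ^ (j * (j + 1) div 2) * x ^ j)"
proof -
  have "(\<lambda>n. q ^ n * norm x) \<longlonglongrightarrow> 0 * norm x"
    by (intro tendsto_intros LIMSEQ_power_zero) (use assms in auto)
  hence "\<forall>\<^sub>F n in sequentially. q ^ n * norm x < 1/2"
    by (intro order_tendstoD) auto
  then obtain N where N: "\<And>n. n \<ge> N \<Longrightarrow> q ^ n * norm x < 1/2"
    by (auto simp: eventually_sequentially)
  show ?thesis
  proof (rule summable_ratio_test)
    fix n assume n: "n \<ge> N"
    have e: "Suc n * (Suc n + 1) div 2 = n * (n + 1) div 2 + Suc n"
    proof -
      have "Suc n * (Suc n + 1) = n * (n + 1) + 2 * Suc n" by simp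
      thus ?thesis by simp
    qed
    have "norm (of_real q ^ (Suc n * (Suc n + 1) div 2) * x ^ Suc n)
        = (q ^ Suc n * norm x) * norm (of_real q ^ (n * (n + 1) div 2) * x ^ n)"
      unfolding e using assms by (simp add: norm_mult norm_power power_add)
    also have "\<dots> \<le> 1/2 * norm (of_real q ^ (n * (n + 1) div 2) * x ^ n)"
      using N[of "Suc n"] n by (intro mult_right_mono) auto
    finally show "norm (of_real q ^ (Suc n * (Suc n + 1) div 2) * x ^ Suc n)
        \<le> 1/2 * norm (of_real q ^ (n * (n + 1) div 2) * x ^ n)" .
  qed simp
qed

definition half_annulus :: "complex set" where
  "half_annulus = {x. Re x \<ge> 0 \<and> 1 < norm x \<and> norm x < 5}"

end

theory Submission
  imports Defs
begin

text \<open>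
  Inside the unit disk, \<open>(1 - x) * \<theta>(q,x) = 1 - (\<Sum>j. d\<^sub>j * x ^ (j + 1))\<close> with positive
  \<open>d\<^sub>j\<close> of sum 1, so a zero would force \<open>x = 1\<close> (Enestroem-Kakeya).

  Outside, let \<open>r = |x| \<ge> 5\<close>, \<open>Re x \<ge> 0\<close> and \<open>q = exp (-t)\<close>. The bilateral series
  \<open>\<Sum>j. q ^ (j * (j + 1) / 2) * x ^ j\<close> over all integers differs from \<open>\<theta>(q,x)\<close> by at most
  \<open>1 / (r - 1)\<close>, and equals \<open>\<Prod>j\<ge>1. (1 - q ^ j) * (1 + x * q ^ j) * (1 + q ^ (j - 1) / x)\<close>.
  On the half-plane the squared modulus of this product is smallest at \<open>x = i * r\<close>, where it
  is \<open>\<Prod>j\<ge>1. (1 - q ^ j) / (1 + q ^ j)\<close> times the bilateral series for \<open>(q\<^sup>2, r\<^sup>2)\<close>.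
  The former is at least \<open>exp (- (pi\<^sup>2 / (4 * t)))\<close>, the largest term of the latter at least
  \<open>exp ((ln r)\<^sup>2 / t) / r\<close>. Since \<open>exp (pi / 2) < 5\<close>, the squared modulus exceeds
  \<open>1 / r > 1 / (r - 1)\<^sup>2\<close>, and \<open>\<theta>(q,x)\<close> cannot vanish. The infinite product is
  approached through its finite form, a case of the \<open>q\<close>-binomial theorem.
\<close>

subsection \<open>A finite form of the triple product identity\<close>

text \<open>The finite q-Pochhammer symbol \<open>(q; q)_n\<close>.\<close>

definition qpoch :: "'a::field \<Rightarrow> nat \<Rightarrow> 'a" where
  "qpoch q n = (\<Prod>j<n. 1 - q ^ Suc j)"

lemma qpoch_0 [simp]: "qpoch q 0 = 1"
  by (simp add: qpoch_def)

lemma qpoch_Suc: "qpoch q (Suc n) = qpoch q n * (1 - q ^ Suc n)"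
  by (simp add: qpoch_def)

lemma qpoch_nonzero:
  assumes "\<And>j. q ^ Suc j \<noteq> 1"
  shows "qpoch q n \<noteq> 0"
  using assms by (auto simp: qpoch_def simp del: power_Suc)

text \<open>The Gaussian binomial coefficient. The value 0 for \<open>m > n\<close> lets the
  q-Pascal rule hold at \<open>m = n\<close> too.\<close>

definition qbinom :: "'a::field \<Rightarrow> nat \<Rightarrow> nat \<Rightarrow> 'a" where
  "qbinom q n m = (if m \<le> n then qpoch q n / (qpoch q m * qpoch q (n - m)) else 0)"

text \<open>One of the two q-Pascal rules. Over a common denominator, with
  \<open>n = m + Suc d\<close>, it is the identity \<open>1 - q ^ Suc n = (1 - q ^ Suc d) + q ^ Suc
  d * (1 - q ^ Suc m)\<close>.\<close>

lemma qbinom_Suc_Suc: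
  assumes "\<And>j. q ^ Suc j \<noteq> 1" "m \<le> n"
  shows "qbinom q (Suc n) (Suc m) = qbinom q n (Suc m) + q ^ (n - m) * qbinom q n m"
proof (cases "m = n")
  case True
  show ?thesis
    using qpoch_nonzero[OF assms(1)] by (simp add: True qbinom_def)
next
  case False
  obtain d where n: "n = m + Suc d"
    using False assms(2) less_imp_Suc_add[of m n] by force
  have nz: "qpoch q k \<noteq> 0" "1 - q ^ Suc k \<noteq> 0" for k
    using qpoch_nonzero[OF assms(1)] assms(1)[of k] by (auto simp del: power_Suc)
  have A: "qbinom q n (Suc m) = qpoch q n * (1 - q ^ Suc d) / (qpoch q (Suc m) * qpoch q (Suc d))"
    using nz(1)[of d] nz(2)[of d] by (simp add: n qbinom_def qpoch_Suc[of q d] del: power_Suc)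
  have B: "qbinom q n m = qpoch q n * (1 - q ^ Suc m) / (qpoch q (Suc m) * qpoch q (Suc d))"
    using nz(1)[of m] nz(2)[of m] by (simp add: n qbinom_def qpoch_Suc[of q m] del: power_Suc)
  have C: "qbinom q (Suc n) (Suc m) = qpoch q n * (1 - q ^ Suc n) / (qpoch q (Suc m) * qpoch q (Suc d))"
    by (simp add: n qbinom_def qpoch_Suc[of q "Suc (m + d)"] del: power_Suc)
  have e: "1 - q ^ Suc n = (1 - q ^ Suc d) + q ^ Suc d * (1 - q ^ Suc m)"
    by (simp add: n algebra_simps power_add)
  thus ?thesis
    unfolding A B C e
    by (simp add: n del: power_Suc) (simp only: distrib_left add_divide_distrib times_divide_eq_right mult_ac)
qed

lemma qbinom_0_right:
  assumes "\<And>j. q ^ Suc j \<noteq> 1"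
  shows "qbinom q n 0 = 1"
  using qpoch_nonzero[OF assms] by (simp add: qbinom_def)

lemma Suc_choose_two: "Suc m choose 2 = (m choose 2) + m"
  by (simp add: numeral_2_eq_2)

lemma add_choose_two: "(a + b) choose 2 = (a choose 2) + (b choose 2) + a * b"
  by (induction a) (simp_all add: Suc_choose_two)

lemma q_binomial:
  assumes "\<And>j. q ^ Suc j \<noteq> (1::'a::field)"
  shows "(\<Prod>j<n. 1 + y * q ^ j) = (\<Sum>m\<le>n. qbinom q n m * q ^ (m choose 2) * y ^ m)"
proof (induction n)
  case 0
  show ?case by (simp add: qbinom_def numeral_2_eq_2)
next
  case (Suc n)
  define f where "f n m = qbinom q n m * q ^ (m choose 2) * y ^ m" for n m
  have f0: "f k 0 = 1" for k
    using assms by (simp add: f_def qbinom_0_right numeral_2_eq_2)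
  have step: "f (Suc n) (Suc m) = f n (Suc m) + y * q ^ n * f n m" if "m \<le> n" for m
  proof -
    have "q ^ n = q ^ (n - m) * q ^ m"
      using that by (simp flip: power_add)
    thus ?thesis
      unfolding f_def qbinom_Suc_Suc[OF assms that] Suc_choose_two
      by (simp add: power_add algebra_simps)
  qed
  have "(\<Sum>m\<le>Suc n. f (Suc n) m) = 1 + (\<Sum>m\<le>n. f (Suc n) (Suc m))"
    by (subst sum.atMost_Suc_shift) (simp add: f0)
  also have "\<dots> = (1 + (\<Sum>m\<le>n. f n (Suc m))) + y * q ^ n * (\<Sum>m\<le>n. f n m)"
    by (simp add: step sum.distrib sum_distrib_left)
  also have "1 + (\<Sum>m\<le>n. f n (Suc m)) = (\<Sum>m\<le>Suc n. f n m)"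
    by (simp only: sum.atMost_Suc_shift f0)
  \<comment> \<open>The top term vanishes because \<open>qbinom q n (Suc n)\<close> is 0.\<close>
  also have "\<dots> = (\<Sum>m\<le>n. f n m)"
    by (simp add: f_def qbinom_def)
  finally show ?case
    using Suc.IH by (simp add: f_def algebra_simps)
qed

text \<open>The factor \<open>qpoch q n\<close> normalises the Gaussian binomial so that, for
  \<open>0 < q < 1\<close>, the value tends to 1 as \<open>n\<close> grows.\<close>

definition triple_coeff :: "'a::field \<Rightarrow> nat \<Rightarrow> nat \<Rightarrow> 'a" where
  "triple_coeff q n k = qpoch q n * qbinom q (2 * n) (n + k)"

text \<open>Apply the q-binomial theorem with \<open>2 * n\<close> factors at
  \<open>y = x / q ^ (n - 1)\<close>. The last \<open>n\<close> factors are
  \<open>1 + x * q ^ Suc j\<close>; the first \<open>n\<close> become \<open>1 + q ^ j / x\<close>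
  once a monomial is pulled out of each. Recentring the sum at \<open>m = n\<close> gives the powers
  of \<open>x\<close> of both signs.\<close>

lemma finite_triple_product:
  assumes "\<And>j. q ^ Suc j \<noteq> (1::'a::field)" "q \<noteq> 0" "x \<noteq> 0"
  shows "qpoch q n * (\<Prod>j<n. (1 + x * q ^ Suc j) * (1 + q ^ j / x)) =
    (\<Sum>k\<le>n. triple_coeff q n k * q ^ (Suc k choose 2) * x ^ k) +
    (\<Sum>k=1..n. triple_coeff q n k * q ^ (k choose 2) / x ^ k)"
proof (cases n)
  case 0
  thus ?thesis by (simp add: triple_coeff_def qbinom_def numeral_2_eq_2)
next
  case (Suc p)
  define y where "y = x / q ^ p"
  have x: "x = y * q ^ p" and y: "y \<noteq> 0"
    using assms by (auto simp: y_def)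
  \<comment> \<open>The product of the monomials pulled out of the first \<open>n\<close> factors.
    It also divides every term of the sum and is cancelled at the end.\<close>
  define C where "C = y ^ n * q ^ (n choose 2)"
  have C: "C \<noteq> 0" using y assms by (simp add: C_def)
  have "(\<Prod>j<n. 1 + y * q ^ j) = (\<Prod>j<n. 1 + y * q ^ (p - j))"
    by (subst prod.nat_diff_reindex[symmetric]) (simp add: Suc)
  also have "\<dots> = (\<Prod>j<n. (y * q ^ (p - j)) * (1 + q ^ j / x))"
  proof (rule prod.cong)
    fix j assume "j \<in> {..<n}"
    hence "q ^ p = q ^ (p - j) * q ^ j" by (simp add: Suc flip: power_add)
    thus "1 + y * q ^ (p - j) = (y * q ^ (p - j)) * (1 + q ^ j / x)"
      using y assms(2) by (simp add: x field_simps)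
  qed simp
  also have "\<dots> = (\<Prod>j<n. y * q ^ (p - j)) * (\<Prod>j<n. 1 + q ^ j / x)"
    by (rule prod.distrib)
  also have "(\<Prod>j<n. y * q ^ (p - j)) = (\<Prod>j<n. y * q ^ j)"
    by (subst prod.nat_diff_reindex[symmetric]) (simp add: Suc)
  also have "\<dots> = C"
    unfolding C_def by (induction n) (simp_all add: Suc_choose_two power_add binomial_eq_0 mult_ac)
  finally have 1: "(\<Prod>j<n. 1 + y * q ^ j) = C * (\<Prod>j<n. 1 + q ^ j / x)" .
  have "(\<Prod>j<2*n. 1 + y * q ^ j) = (\<Prod>j<n. 1 + y * q ^ j) * (\<Prod>j<n. 1 + y * q ^ (n + j))"
    by (simp add: mult_2 prod.nat_group lessThan_atLeast0 prod.atLeastLessThan_concat[of 0 n "n+n", symmetric]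
        prod.shift_bounds_nat_ivl[of _ 0 n n, simplified] add.commute)
  also have "(\<Prod>j<n. 1 + y * q ^ (n + j)) = (\<Prod>j<n. 1 + x * q ^ Suc j)"
    by (simp add: x Suc power_add mult_ac)
  finally have lhs: "(\<Prod>j<2*n. 1 + y * q ^ j) =
      C * (\<Prod>j<n. (1 + x * q ^ Suc j) * (1 + q ^ j / x))"
    by (simp add: 1 prod.distrib mult_ac)

  define g where "g m = qbinom q (2 * n) m * q ^ (m choose 2) * y ^ m" for m
  have sym: "qbinom q (2 * n) (n - k) = qbinom q (2 * n) (n + k)" if "k \<le> n" for k
    using that by (simp add: qbinom_def mult_2 mult.commute)
  have up: "g (n + k) = C * (qbinom q (2 * n) (n + k) * q ^ (Suc k choose 2) * x ^ k)" for k
  proof -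
    have e: "(n + k) choose 2 = (n choose 2) + (Suc k choose 2) + p * k"
      by (simp add: add_choose_two Suc_choose_two) (simp add: Suc)
    show ?thesis
      unfolding g_def e C_def x by (simp add: power_add power_mult[symmetric] power_mult_distrib mult_ac)
  qed
  have down: "g (n - k) = C * (qbinom q (2 * n) (n + k) * q ^ (k choose 2) / x ^ k)"
    if k: "k \<in> {1..n}" for k
  proof -
    \<comment> \<open>Multiplying by \<open>x ^ k\<close> clears the negative power; the symmetry of
      the Gaussian binomial then replaces \<open>n - k\<close> by \<open>n + k\<close>.\<close>
    define m where "m = n - k"
    have n: "n = m + k" using k by (simp add: m_def)
    have e: "(m choose 2) + p * k = (n choose 2) + (k choose 2)"
    proof -
      have "k * k = 2 * (k choose 2) + k"
        by (induction k) (simp_all add: Suc_choose_two)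
      moreover have "p * k + k = m * k + k * k"
        using n Suc by (metis add_mult_distrib mult_Suc add.commute)
      ultimately show ?thesis by (simp add: n add_choose_two)
    qed
    have "g m * x ^ k = qbinom q (2 * n) m * (q ^ ((m choose 2) + p * k)) * y ^ n"
      by (simp add: g_def x power_add power_mult[symmetric] power_mult_distrib mult_ac n)
    also have "\<dots> = C * (qbinom q (2 * n) (n + k) * q ^ (k choose 2))"
      unfolding e C_def using sym[of k] k by (simp add: power_add mult_ac m_def)
    finally show ?thesis
      using assms(3) by (simp add: m_def field_simps)
  qed
  have "(\<Prod>j<2*n. 1 + y * q ^ j) = (\<Sum>m\<le>2*n. g m)"
    by (simp add: q_binomial[OF assms(1)] g_def)
  also have "\<dots> = (\<Sum>m\<in>{n..2*n}. g m) + (\<Sum>m\<in>{..<n}. g m)"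
    by (subst sum.union_disjoint[symmetric]) (auto intro: sum.cong)
  also have "(\<Sum>m\<in>{n..2*n}. g m) = (\<Sum>k\<le>n. g (n + k))"
    by (rule sum.reindex_bij_witness[of _ "\<lambda>k. n + k" "\<lambda>m. m - n"]) auto
  also have "(\<Sum>m\<in>{..<n}. g m) = (\<Sum>k=1..n. g (n - k))"
    by (rule sum.reindex_bij_witness[of _ "\<lambda>k. n - k" "\<lambda>m. n - m"]) auto
  also have "(\<Sum>k\<le>n. g (n + k)) =
      C * (\<Sum>k\<le>n. qbinom q (2 * n) (n + k) * q ^ (Suc k choose 2) * x ^ k)"
    by (simp add: up sum_distrib_left)
  also have "(\<Sum>k=1..n. g (n - k)) =
      C * (\<Sum>k=1..n. qbinom q (2 * n) (n + k) * q ^ (k choose 2) / x ^ k)"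
    by (simp add: down sum_distrib_left)
  finally have "(\<Prod>j<n. (1 + x * q ^ Suc j) * (1 + q ^ j / x)) =
      (\<Sum>k\<le>n. qbinom q (2 * n) (n + k) * q ^ (Suc k choose 2) * x ^ k) +
      (\<Sum>k=1..n. qbinom q (2 * n) (n + k) * q ^ (k choose 2) / x ^ k)"
    using C by (simp add: lhs flip: distrib_left)
  thus ?thesis
    by (simp add: triple_coeff_def distrib_left sum_distrib_left mult_ac)
qed

subsection \<open>The coefficients for a real base\<close>

lemma qpoch_pos:
  assumes "0 < q" "q < (1::real)"
  shows "0 < qpoch q n"
  unfolding qpoch_def using assms by (intro prod_pos) (auto simp: power_Suc_less_one simp del: power_Suc)

lemma qpoch_antimono:
  assumes "0 < q" "q < (1::real)" "m \<le> n"
  shows "qpoch q n \<le> qpoch q m"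
  using assms(3)
proof (induction rule: dec_induct)
  case (step n)
  have "qpoch q (Suc n) \<le> qpoch q n * 1"
    unfolding qpoch_Suc using assms qpoch_pos[OF assms(1,2), of n]
    by (intro mult_left_mono) auto
  thus ?case using step by simp
qed simp

text \<open>The Pochhammer values are paired so that each quotient has the larger index on top:
  monotonicity then bounds both by 1, and both tend to 1.\<close>

lemma triple_coeff_eq:
  "triple_coeff q n k =
    (if k \<le> n then (qpoch q (2 * n) / qpoch q (n + k)) * (qpoch q n / qpoch q (n - k)) else 0)"
  by (simp add: triple_coeff_def qbinom_def mult_2)

lemma triple_coeff_bounds:
  assumes "0 < q" "q < (1::real)"
  shows "0 \<le> triple_coeff q n k" "triple_coeff q n k \<le> 1"
proof -
  show "0 \<le> triple_coeff q n k"
    using qpoch_pos[OF assms] by (simp add: triple_coeff_eq less_imp_le)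
  show "triple_coeff q n k \<le> 1"
  proof -
    have "0 \<le> qpoch q a / qpoch q b \<and> qpoch q a / qpoch q b \<le> 1" if "b \<le> a" for a b
      using qpoch_pos[OF assms, of a] qpoch_pos[OF assms, of b] qpoch_antimono[OF assms that] by simp
    thus ?thesis
      unfolding triple_coeff_eq by (cases "k \<le> n") (simp_all add: mult_le_one del: times_divide_eq_left times_divide_eq_right times_divide_times_eq)
  qed
qed

section \<open>A lower bound for the product of \<open>(1 - q ^ j) / (1 + q ^ j)\<close>, and limits
  of the coefficients\<close>

lemma sums_inverse_odd_squares: "(\<lambda>m. 1 / (2 * real m + 1)\<^sup>2) sums (pi\<^sup>2 / 8)"
proof -
  have "(\<lambda>n. \<Sum>i\<in>{n*2..<n*2+2}. 1 / (real i + 1)\<^sup>2) sums (pi\<^sup>2 / 6)"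
    using sums_group[OF inverse_squares_sums, of 2] by (simp add: add_ac mult_ac)
  also have "(\<lambda>n. \<Sum>i\<in>{n*2..<n*2+2}. 1 / (real i + 1)\<^sup>2) =
      (\<lambda>n. 1 / (2 * real n + 1)\<^sup>2 + 1 / 4 * (1 / (real n + 1)\<^sup>2))"
  proof
    fix n
    have "{n*2..<n*2+2} = {2*n, Suc (2*n)}" by auto
    moreover have "(2 * real n + 2)\<^sup>2 = 4 * (real n + 1)\<^sup>2"
      by (simp add: power2_eq_square algebra_simps)
    ultimately show "(\<Sum>i\<in>{n*2..<n*2+2}. 1 / (real i + 1)\<^sup>2) =
        1 / (2 * real n + 1)\<^sup>2 + 1 / 4 * (1 / (real n + 1)\<^sup>2)"
      by (simp add: add_ac)
  qed
  \<comment> \<open>The even squares contribute a quarter of the full sum and are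
    subtracted.\<close>
  finally have "(\<lambda>n. (1 / (2 * real n + 1)\<^sup>2 + 1 / 4 * (1 / (real n + 1)\<^sup>2)) - 1 / 4 * (1 / (real n + 1)\<^sup>2))
     sums (pi\<^sup>2 / 6 - 1 / 4 * (pi\<^sup>2 / 6))"
    by (intro sums_diff sums_mult) (use inverse_squares_sums in \<open>simp_all add: add_ac\<close>)
  thus ?thesis by simp
qed

lemma sum_exp_geometric_le:
  assumes "0 < (s::real)"
  shows "(\<Sum>j<n. exp (-s) ^ Suc j) \<le> 1 / s"
proof -
  define p where "p = exp (-s)"
  have p: "0 < p" "p < 1" using assms by (auto simp: p_def)
  have "(\<Sum>j<n. p ^ Suc j) = p * (\<Sum>j<n. p ^ j)" by (simp add: sum_distrib_left)
  also have "\<dots> \<le> p * (1 / (1 - p))"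
    using p by (intro mult_left_mono) (auto simp: sum_gp_strict divide_right_mono)
  also have "\<dots> = 1 / (exp s - 1)"
    using assms by (simp add: p_def exp_minus field_simps)
  also have "\<dots> \<le> 1 / s"
  proof (rule divide_left_mono)
    show "s \<le> exp s - 1" using exp_ge_add_one_self[of s] by linarith
  qed (use assms in auto)
  finally show ?thesis by (simp add: p_def)
qed

text \<open>
  Expanding the logarithm of each factor turns the double sum into
  \<open>\<Sum>m. 2 / ((2 * m + 1) * (exp ((2 * m + 1) * t) - 1))\<close>,
  and \<open>exp s - 1 \<ge> s\<close> reduces it to the sum of the inverse odd squares.
\<close>
lemma prod_tanh_lower_bound:
  fixes t :: real
  assumes t: "0 < t" and q: "q = exp (-t)"
  shows "exp (- (pi\<^sup>2 / (4 * t))) \<le> (\<Prod>j<n. (1 - q ^ Suc j) / (1 + q ^ Suc j))"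
proof -
  have q01: "0 < q" "q < 1" using t by (auto simp: q)
  have pos: "0 < (1 - q ^ Suc j) / (1 + q ^ Suc j)" for j
    using q01 power_Suc_less_one[of q j] by (intro divide_pos_pos add_pos_pos) (auto simp del: power_Suc)
  have "(\<lambda>m. - (2 * (q ^ Suc j) ^ (2*m+1) / (2 * real m + 1))) sums
      ln ((1 - q ^ Suc j) / (1 + q ^ Suc j))" for j
  proof -
    define y where "y = q ^ Suc j"
    have y: "0 < y" "y < 1"
      using q01 power_Suc_less_one[of q j] by (auto simp: y_def)
    \<comment> \<open>\<open>ln_series_quadratic\<close> expands \<open>ln z\<close> in odd powers
      of \<open>(z - 1) / (z + 1)\<close>, which is \<open>- y\<close> here.\<close>
    have "((1 - y) / (1 + y) - 1) / ((1 - y) / (1 + y) + 1) = - y"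
      using y by (simp add: field_simps)
    moreover have "2 * (- y) ^ (2*m+1) / of_nat (2*m+1) = - (2 * y ^ (2*m+1) / (2 * real m + 1))" for m
      by (simp add: add_ac)
    ultimately show ?thesis
      using ln_series_quadratic[OF pos[of j]] unfolding y_def[symmetric] by (simp add: add_ac)
  qed
  hence "(\<lambda>m. \<Sum>j<n. - (2 * (q ^ Suc j) ^ (2*m+1) / (2 * real m + 1))) sums
      (\<Sum>j<n. ln ((1 - q ^ Suc j) / (1 + q ^ Suc j)))"
    by (rule sums_sum)
  moreover have "(\<lambda>m. - (2 / t) * (1 / (2 * real m + 1)\<^sup>2)) sums (- (2 / t) * (pi\<^sup>2 / 8))"
    by (intro sums_mult sums_inverse_odd_squares)
  moreover have "- (2 / t) * (1 / (2 * real m + 1)\<^sup>2) \<le>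
      (\<Sum>j<n. - (2 * (q ^ Suc j) ^ (2*m+1) / (2 * real m + 1)))" for m
  proof -
    define d where "d = 2 * real m + 1"
    have d: "d > 0" by (simp add: d_def)
    have "(q ^ Suc j) ^ (2*m+1) = exp (- (d * t)) ^ Suc j" for j
      unfolding q d_def by (simp only: exp_of_nat_mult[symmetric]) (simp add: algebra_simps)
    hence "(\<Sum>j<n. - (2 * (q ^ Suc j) ^ (2*m+1) / d)) =
        - (2 / d) * (\<Sum>j<n. exp (- (d * t)) ^ Suc j)"
      by (simp add: sum_distrib_left sum_negf del: power_Suc)
    also have "\<dots> \<ge> - (2 / d) * (1 / (d * t))"
      using d t by (intro mult_left_mono_neg sum_exp_geometric_le) auto
    finally show ?thesis
      unfolding d_def by (simp add: power2_eq_square mult_ac)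
  qed
  ultimately have "- (2 / t) * (pi\<^sup>2 / 8) \<le> (\<Sum>j<n. ln ((1 - q ^ Suc j) / (1 + q ^ Suc j)))"
    by (meson sums_le)
  also have "\<dots> = ln (\<Prod>j<n. (1 - q ^ Suc j) / (1 + q ^ Suc j))"
    using less_imp_neq[OF pos, symmetric] by (intro ln_prod[symmetric]) blast+
  finally have "exp (- (2 / t) * (pi\<^sup>2 / 8)) \<le> (\<Prod>j<n. (1 - q ^ Suc j) / (1 + q ^ Suc j))"
    using pos by (subst (asm) ln_ge_iff) (auto intro!: prod_pos simp del: power_Suc)
  thus ?thesis by simp
qed

text \<open>The point is that the limit is nonzero, so that quotients of Pochhammer values tend to
  1. Since \<open>(1 - z) / (1 + z) \<le> 1 - z\<close> for \<open>0 < z < 1\<close>, the preceding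
  product bound keeps the decreasing sequence away from 0.\<close>

lemma qpoch_tendsto:
  assumes "0 < q" "q < (1::real)"
  obtains L where "L > 0" "qpoch q \<longlonglongrightarrow> L"
proof -
  define t where "t = - ln q"
  have t: "t > 0" "q = exp (-t)" using assms by (auto simp: t_def)
  define c where "c = exp (- (pi\<^sup>2 / (4 * t)))"
  have lower: "c \<le> qpoch q n" for n
  proof -
    have "c \<le> (\<Prod>j<n. (1 - q ^ Suc j) / (1 + q ^ Suc j))"
      unfolding c_def by (rule prod_tanh_lower_bound[OF t])
    also have "\<dots> \<le> qpoch q n"
      unfolding qpoch_def
    proof (rule prod_mono)
      fix j
      have "0 < q ^ Suc j" "q ^ Suc j < 1"
        using assms power_Suc_less_one[of q j] by auto
      thus "0 \<le> (1 - q ^ Suc j) / (1 + q ^ Suc j) \<and>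
          (1 - q ^ Suc j) / (1 + q ^ Suc j) \<le> 1 - q ^ Suc j"
        by (auto simp: divide_le_eq simp del: power_Suc intro!: mult_left_le)
    qed
    finally show ?thesis .
  qed
  have "decseq (qpoch q)"
    using qpoch_antimono[OF assms] by (simp add: decseq_def)
  then obtain L where L: "qpoch q \<longlonglongrightarrow> L"
    using decseq_convergent[of "qpoch q" c] lower by blast
  have "c \<le> L" by (rule LIMSEQ_le_const[OF L]) (use lower in auto)
  moreover have "c > 0" by (simp add: c_def)
  ultimately show ?thesis using that[of L] L by simp
qed

lemma triple_coeff_tendsto:
  assumes "0 < q" "q < (1::real)"
  shows "(\<lambda>n. triple_coeff q n k) \<longlonglongrightarrow> 1"
proof -
  obtain L where L: "L > 0" "qpoch q \<longlonglongrightarrow> L" using qpoch_tendsto[OF assms] .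
  have "(\<lambda>n. (qpoch q (2 * n) / qpoch q (n + k)) * (qpoch q n / qpoch q (n - k))) \<longlonglongrightarrow> (L / L) * (L / L)"
  proof (intro tendsto_mult tendsto_divide)
    show "(\<lambda>n. qpoch q (2 * n)) \<longlonglongrightarrow> L"
      by (rule filterlim_compose[OF L(2) mult_nat_left_at_top]) simp
    show "(\<lambda>n. qpoch q (n + k)) \<longlonglongrightarrow> L"
      by (rule LIMSEQ_ignore_initial_segment[OF L(2)])
    show "(\<lambda>n. qpoch q (n - k)) \<longlonglongrightarrow> L"
      by (rule filterlim_compose[OF L(2) filterlim_minus_const_nat_at_top])
  qed (use L in auto)
  moreover have "eventually (\<lambda>n. triple_coeff q n k =
      (qpoch q (2 * n) / qpoch q (n + k)) * (qpoch q n / qpoch q (n - k))) sequentially"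
    using eventually_ge_at_top[of k] by eventually_elim (simp add: triple_coeff_eq)
  ultimately show ?thesis
    using L by (simp add: tendsto_cong)
qed

subsection \<open>Zero-free regions\<close>

lemma of_real_qpoch: "qpoch (of_real q :: 'a::real_field) n = of_real (qpoch q n)"
  by (simp add: qpoch_def)

lemma of_real_triple_coeff:
  "triple_coeff (of_real q :: 'a::real_field) n k = of_real (triple_coeff q n k)"
  by (simp add: triple_coeff_def qbinom_def of_real_qpoch)

text \<open>Tannery's theorem: the coefficients lie in \<open>[0, 1]\<close> and tend to 1, and the
  theta series converges absolutely, which is its convergence at \<open>norm x\<close>.\<close>

lemma partial_theta_limit:
  assumes q: "0 < q" "q < 1"
  shows "(\<lambda>n. \<Sum>k\<le>n. of_real (triple_coeff q n k) * of_real q ^ (Suc k choose 2) * x ^ k)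
    \<longlonglongrightarrow> partial_theta q x"
proof -
  define a where "a k = of_real q ^ (Suc k choose 2) * x ^ k" for k
  have e: "Suc k choose 2 = k * (k + 1) div 2" for k
    by (simp add: choose_two mult.commute)
  have "summable (\<lambda>k. complex_of_real (q ^ (k * (k + 1) div 2) * norm x ^ k))"
    using summable_partial_theta[OF q, of "of_real (norm x)"] by simp
  hence summable: "summable (\<lambda>k. norm (a k))"
    using q by (simp only: summable_complex_of_real) (simp add: a_def e norm_mult norm_power)
  have "(\<lambda>n. \<Sum>k. of_real (triple_coeff q n k) * a k) \<longlonglongrightarrow> (\<Sum>k. of_real 1 * a k)"
  proof (rule tannerys_theorem[where M = "\<lambda>k. norm (a k)", THEN conjunct2, THEN conjunct2])
    show "(\<lambda>n. of_real (triple_coeff q n k) * a k) \<longlonglongrightarrow> of_real 1 * a k" for k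
      by (intro tendsto_intros triple_coeff_tendsto q)
    have "norm (of_real (triple_coeff q n k) * a k) \<le> norm (a k)" for n k
      using triple_coeff_bounds[OF q, of n k] by (simp add: norm_mult mult_left_le_one_le)
    thus "\<forall>\<^sub>F (k, n) in sequentially \<times>\<^sub>F sequentially.
        norm (of_real (triple_coeff q n k) * a k) \<le> norm (a k)"
      by (auto intro: always_eventually)
  qed (use summable in auto)
  \<comment> \<open>\<open>triple_coeff q n k\<close> is 0 for \<open>k > n\<close>, so the series
    is a finite sum.\<close>
  also have "(\<lambda>n. \<Sum>k. of_real (triple_coeff q n k) * a k) =
      (\<lambda>n. \<Sum>k\<le>n. of_real (triple_coeff q n k) * a k)"
    by (intro ext suminf_finite) (auto simp: triple_coeff_eq)
  finally show ?thesis
    by (simp add: a_def partial_theta_def e mult.assoc)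
qed

section \<open>The finite product on the closed right half-plane\<close>

lemma norm_one_plus_ge:
  fixes z :: complex
  assumes "Re z \<ge> 0"
  shows "1 + (norm z)\<^sup>2 \<le> (norm (1 + z))\<^sup>2"
  unfolding cmod_power2 using assms by (simp add: power2_eq_square algebra_simps)

text \<open>Dropping the nonnegative \<open>2 * Re z\<close> from each
  \<open>(norm (1 + z))\<^sup>2\<close> leaves the product for base \<open>q\<^sup>2\<close> at
  \<open>r\<^sup>2\<close>. Its expansion has nonnegative terms only, so any single term bounds it
  from below.\<close>

lemma finite_product_lower_bound:
  fixes t :: real and x :: complex
  assumes t: "0 < t" and q: "q = exp (-t)" and x: "x \<noteq> 0" "Re x \<ge> 0"
  shows "exp (- (pi\<^sup>2 / (4 * t))) *
      (triple_coeff (q\<^sup>2) n k * (q\<^sup>2) ^ (Suc k choose 2) * ((norm x)\<^sup>2) ^ k) \<le>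
    (norm (qpoch (of_real q) n * (\<Prod>j<n. (1 + x * of_real q ^ Suc j) * (1 + of_real q ^ j / x))))\<^sup>2"
proof -
  define r where "r = norm x"
  have r: "r > 0" using x by (simp add: r_def)
  have q01: "0 < q" "q < 1" using t by (auto simp: q)
  have qq: "0 < q\<^sup>2" "q\<^sup>2 < 1" using q01 by (auto simp: power_less_one_iff)
  have qj: "0 < q ^ Suc j" "q ^ Suc j < 1" for j
    using q01 power_Suc_less_one[of q j] by auto
  have qq': "(q\<^sup>2) ^ Suc j \<noteq> 1" for j
    using qq power_Suc_less_one[of "q\<^sup>2" j] by auto
  define E where "E j = (1 + r\<^sup>2 * (q\<^sup>2) ^ Suc j) * (1 + (q\<^sup>2) ^ j / r\<^sup>2)" for j
  have E: "E j \<ge> 0" for j using r qq by (simp add: E_def less_imp_le)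
  have "triple_coeff (q\<^sup>2) n k * (q\<^sup>2) ^ (Suc k choose 2) * (r\<^sup>2) ^ k \<le>
      (\<Sum>k\<le>n. triple_coeff (q\<^sup>2) n k * (q\<^sup>2) ^ (Suc k choose 2) * (r\<^sup>2) ^ k)"
  proof (cases "k \<le> n")
    case True
    thus ?thesis
      by (intro member_le_sum) (auto intro!: mult_nonneg_nonneg triple_coeff_bounds qq)
  next
    case False
    thus ?thesis
      by (auto simp: triple_coeff_eq[of _ _ k] intro!: sum_nonneg mult_nonneg_nonneg triple_coeff_bounds qq)
  qed
  also have "\<dots> \<le> qpoch (q\<^sup>2) n * (\<Prod>j<n. E j)"
    unfolding E_def using qq r qq'
    by (subst finite_triple_product) (auto intro!: sum_nonneg mult_nonneg_nonneg divide_nonneg_nonneg triple_coeff_bounds simp del: power_Suc)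
  finally have "exp (- (pi\<^sup>2 / (4 * t))) *
      (triple_coeff (q\<^sup>2) n k * (q\<^sup>2) ^ (Suc k choose 2) * (r\<^sup>2) ^ k) \<le>
      (\<Prod>j<n. (1 - q ^ Suc j) / (1 + q ^ Suc j)) * (qpoch (q\<^sup>2) n * (\<Prod>j<n. E j))"
  proof (rule mult_mono[OF prod_tanh_lower_bound[OF t q]])
    show "0 \<le> (\<Prod>j<n. (1 - q ^ Suc j) / (1 + q ^ Suc j))"
      using qj by (intro prod_nonneg divide_nonneg_nonneg) (auto simp: less_imp_le add_nonneg_nonneg simp del: power_Suc)
    show "0 \<le> triple_coeff (q\<^sup>2) n k * (q\<^sup>2) ^ (Suc k choose 2) * (r\<^sup>2) ^ k"
      using triple_coeff_bounds[OF qq] by simp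
  qed
  \<comment> \<open>Because \<open>1 - q ^ (2 * j) = (1 - q ^ j) * (1 + q ^ j)\<close>, the two
    prefactors combine to the square of \<open>qpoch q n\<close>.\<close>
  also have "\<dots> = (\<Prod>j<n. (1 - q ^ Suc j)\<^sup>2 * E j)"
    unfolding qpoch_def prod.distrib[symmetric]
  proof (rule prod.cong)
    fix j
    have "1 - (q\<^sup>2) ^ Suc j = (1 - q ^ Suc j) * (1 + q ^ Suc j)"
      by (simp add: power_mult[symmetric] algebra_simps power2_eq_square power_mult_distrib)
    moreover have "1 + q ^ Suc j \<noteq> 0" using qj[of j] by simp
    ultimately show "(1 - q ^ Suc j) / (1 + q ^ Suc j) * ((1 - (q\<^sup>2) ^ Suc j) * E j) = (1 - q ^ Suc j)\<^sup>2 * E j"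
      by (simp add: power2_eq_square del: power_Suc)
  qed simp
  also have "\<dots> \<le> (\<Prod>j<n. (1 - q ^ Suc j)\<^sup>2 *
      ((norm (1 + x * of_real q ^ Suc j))\<^sup>2 * (norm (1 + of_real q ^ j / x))\<^sup>2))"
  proof (rule prod_mono, intro conjI mult_left_mono)
    fix j
    have "1 + r\<^sup>2 * (q\<^sup>2) ^ Suc j \<le> (norm (1 + x * of_real q ^ Suc j))\<^sup>2"
    proof -
      have "Re (x * of_real q ^ Suc j) \<ge> 0"
        using x qj[of j] by (simp flip: of_real_power del: power_Suc)
      from norm_one_plus_ge[OF this] show ?thesis
        using q01 by (simp add: norm_mult norm_power r_def power_mult_distrib
            power_mult[symmetric] mult.commute del: power_Suc)
    qed
    moreover have "1 + (q\<^sup>2) ^ j / r\<^sup>2 \<le> (norm (1 + of_real q ^ j / x))\<^sup>2"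
    proof -
      have "Re (of_real q ^ j / x) \<ge> 0"
        using x q01 by (simp add: Re_divide flip: of_real_power)
      from norm_one_plus_ge[OF this] show ?thesis
        using q01 by (simp add: norm_divide norm_power r_def power_divide
            power_mult[symmetric] mult.commute del: power_Suc)
    qed
    ultimately show "E j \<le> (norm (1 + x * of_real q ^ Suc j))\<^sup>2 * (norm (1 + of_real q ^ j / x))\<^sup>2"
      unfolding E_def using qq r by (intro mult_mono) (auto simp: less_imp_le)
  qed (use E in auto)
  also have "\<dots> = (norm (qpoch (of_real q) n *
      (\<Prod>j<n. (1 + x * of_real q ^ Suc j) * (1 + of_real q ^ j / x))))\<^sup>2"
  proof -
    have "norm (qpoch (of_real q :: complex) n) = (\<Prod>j<n. 1 - q ^ Suc j)"
      using qpoch_pos[OF q01, of n] by (simp add: of_real_qpoch) (simp add: qpoch_def)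
    thus ?thesis
      by (simp add: norm_mult prod_norm[symmetric] prod.distrib power_mult_distrib prod_power_distrib
          del: power_Suc)
  qed
  finally show ?thesis by (simp add: r_def)
qed

section \<open>Size of the dominant term\<close>

lemma pi_half_less_ln_5: "pi / 2 < ln 5"
proof -
  \<comment> \<open>8/5 is a rational between \<open>pi / 2\<close>, about 1.571, and
    \<open>ln 5\<close>, about 1.609. The fifth power reduces the claim to
    \<open>exp 1 ^ 8 < 3125\<close>.\<close>
  have "exp (8 / 5 :: real) ^ 5 = exp 1 ^ 8"
    by (simp flip: exp_of_nat_mult)
  also have "\<dots> < (272 / 100) ^ 8"
    by (intro power_strict_mono e_less_272) auto
  also have "\<dots> < 5 ^ 5" by (simp add: power_numeral_reduce)
  finally have "exp (8 / 5 :: real) < 5" by (rule power_less_imp_less_base) simp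
  hence "8 / 5 < ln (5 :: real)" by (subst ln_exp[symmetric], subst ln_less_cancel_iff) auto
  thus ?thesis using pi_approx by simp
qed

text \<open>
  The dominant term of the bilateral series for base \<open>q\<^sup>2\<close>: the exponent
  \<open>2 * k * ln r - t * k * (k + 1)\<close> is largest for \<open>k\<close> next to \<open>ln r / t\<close>.
\<close>
lemma dominant_term_bound:
  fixes t r :: real
  assumes t: "0 < t" and q: "q = exp (-t)" and r: "5 \<le> r"
  obtains k where "1 / r < exp (- (pi\<^sup>2 / (4 * t))) * ((q\<^sup>2) ^ (Suc k choose 2) * (r\<^sup>2) ^ k)"
proof -
  define L where "L = ln r"
  have rL: "r = exp L" using r by (simp add: L_def)
  have L: "pi / 2 < L"
    using pi_half_less_ln_5 r by (simp add: L_def) (rule less_le_trans, auto)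
  define s where "s = L / t"
  have L_eq: "L = s * t" using t by (simp add: s_def)
  have s: "s > 0" using order.strict_trans[OF pi_half_gt_zero L] t by (simp add: s_def)
  \<comment> \<open>The exponent is \<open>t * (2 * k * s - k * (k + 1))\<close>, with real
    maximiser \<open>s - 1/2\<close>; the floor of \<open>s\<close> is a nearest integer to
    it.\<close>
  define k where "k = nat \<lfloor>s\<rfloor>"
  have k: "real k \<le> s" "s \<le> real k + 1" using s by (auto simp: k_def)
  \<comment> \<open>Expanded and multiplied by \<open>t\<close>, this bounds the exponent below by
    \<open>L\<^sup>2 / t - L\<close>. The first part beats \<open>pi\<^sup>2 / (4 * t)\<close>; the
    second leaves the factor \<open>1 / r\<close>.\<close>
  have "(s - real k) * (s - (real k + 1)) \<le> 0"
    using k by (intro mult_nonneg_nonpos) auto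
  hence "t * (s * s - s) \<le> t * (2 * real k * s - real k * (real k + 1))"
    using t by (intro mult_left_mono) (auto simp: algebra_simps)
  moreover have "(pi / 2)\<^sup>2 < L\<^sup>2"
    using L pi_gt_zero by (intro power_strict_mono) auto
  hence "pi\<^sup>2 / (4 * t) < t * (s * s)"
    using t by (simp add: L_eq power2_eq_square field_simps)
  ultimately have "- L < - (pi\<^sup>2 / (4 * t)) + (- t * (real k * (real k + 1)) + 2 * real k * L)"
    by (simp add: L_eq algebra_simps)
  hence "exp (- L) < exp (- (pi\<^sup>2 / (4 * t)) + (- t * (real k * (real k + 1)) + 2 * real k * L))"
    by simp
  also have "\<dots> = exp (- (pi\<^sup>2 / (4 * t))) * (exp (- t * (real k * (real k + 1))) * exp (2 * real k * L))"
    by (simp only: exp_add)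
  also have "exp (- t * (real k * (real k + 1))) = (q\<^sup>2) ^ (Suc k choose 2)"
  proof -
    have "2 * (Suc k choose 2) = k * (k + 1)"
      by (induction k) (simp_all add: Suc_choose_two numeral_2_eq_2)
    hence "real k * (real k + 1) = real (2 * (Suc k choose 2))"
      by (simp add: algebra_simps)
    thus ?thesis
      by (simp only: q power_mult[symmetric] exp_of_nat_mult[symmetric]) (simp add: mult_ac)
  qed
  also have "exp (2 * real k * L) = (r\<^sup>2) ^ k"
    by (simp add: rL power_mult[symmetric] exp_of_nat_mult[symmetric])
  finally show ?thesis
    using that[of k] by (simp add: rL exp_minus inverse_eq_divide)
qed

section \<open>No zeros in the half-plane at modulus 5 or more\<close>

lemma partial_theta_nonzero_outside:
  fixes x :: complex
  assumes q: "0 < q" "q < 1" and x: "Re x \<ge> 0" "norm x \<ge> 5"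
  shows "partial_theta q x \<noteq> 0"
proof
  assume zero: "partial_theta q x = 0"
  define t where "t = - ln q"
  have t: "0 < t" "q = exp (-t)" using q by (auto simp: t_def)
  define r where "r = norm x"
  have r: "r \<ge> 5" "x \<noteq> 0" using x by (auto simp: r_def)
  have qq: "0 < q\<^sup>2" "q\<^sup>2 < 1" using q by (auto simp: power_less_one_iff)
  have qj: "of_real q ^ Suc j \<noteq> (1::complex)" for j
    using q power_Suc_less_one[of q j] by (metis of_real_eq_1_iff of_real_power less_irrefl)
  define S where "S n = (\<Sum>k\<le>n. of_real (triple_coeff q n k) * of_real q ^ (Suc k choose 2) * x ^ k)" for n
  define P where "P n = qpoch (of_real q) n *
    (\<Prod>j<n. (1 + x * of_real q ^ Suc j) * (1 + of_real q ^ j / x))" for n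
  obtain k where k: "1 / r < exp (- (pi\<^sup>2 / (4 * t))) * ((q\<^sup>2) ^ (Suc k choose 2) * (r\<^sup>2) ^ k)" (is "_ < ?K")
    using dominant_term_bound[OF t r(1)] .
  have upper: "norm (P n) \<le> norm (S n) + 1 / (r - 1)" for n
  proof -
    \<comment> \<open>The negative powers: with coefficients at most 1 they are dominated by a
      geometric series of sum \<open>1 / (r - 1)\<close>.\<close>
    define G where "G = (\<Sum>k=1..n. of_real (triple_coeff q n k) * of_real q ^ (k choose 2) / x ^ k)"
    have "P n = S n + G"
      unfolding P_def S_def G_def using finite_triple_product[OF qj, of x n] q r
      by (simp add: of_real_triple_coeff)
    hence "norm (P n) \<le> norm (S n) + norm G" by (simp add: norm_triangle_ineq)
    also have "norm G \<le> (\<Sum>k=1..n. (1 / r) ^ k)"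
      unfolding G_def
    proof (rule sum_norm_le)
      fix k
      have "triple_coeff q n k * q ^ (k choose 2) \<le> 1"
        using q triple_coeff_bounds[OF q] by (intro mult_le_one) (auto simp: power_le_one)
      thus "norm (of_real (triple_coeff q n k) * of_real q ^ (k choose 2) / x ^ k) \<le> (1 / r) ^ k"
        using q r triple_coeff_bounds[OF q, of n k]
        by (simp add: norm_mult norm_divide norm_power power_divide divide_right_mono flip: r_def)
    qed
    also have "\<dots> = (\<Sum>j<n. (1 / r) ^ Suc j)"
      by (simp add: sum.atLeast1_atMost_eq)
    also have "\<dots> = 1 / r * ((1 - (1 / r) ^ n) / (1 - 1 / r))"
      using r by (simp only: power_Suc sum_distrib_left[symmetric] sum_gp_strict) simp
    also have "\<dots> \<le> 1 / r * (1 / (1 - 1 / r))"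
      using r by (intro mult_left_mono divide_right_mono) auto
    also have "\<dots> = 1 / (r - 1)"
      using r by (simp add: field_simps)
    finally show ?thesis by simp
  qed
  \<comment> \<open>As \<open>n\<close> grows, \<open>S n\<close> tends to the assumed value 0, so
    only the bound on the negative powers remains above the fixed term \<open>k\<close>.\<close>
  have "?K \<le> (0 + 1 / (r - 1))\<^sup>2"
  proof (rule LIMSEQ_le)
    show "(\<lambda>n. exp (- (pi\<^sup>2 / (4 * t))) *
      (triple_coeff (q\<^sup>2) n k * (q\<^sup>2) ^ (Suc k choose 2) * (r\<^sup>2) ^ k)) \<longlonglongrightarrow> ?K"
      by (rule tendsto_eq_intros triple_coeff_tendsto qq refl | simp)+
    have "S \<longlonglongrightarrow> 0"
      unfolding S_def using partial_theta_limit[OF q, of x] zero by simp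
    thus "(\<lambda>n. (norm (S n) + 1 / (r - 1))\<^sup>2) \<longlonglongrightarrow> (0 + 1 / (r - 1))\<^sup>2"
      by (intro tendsto_intros tendsto_norm_zero)
    have "exp (- (pi\<^sup>2 / (4 * t))) *
        (triple_coeff (q\<^sup>2) n k * (q\<^sup>2) ^ (Suc k choose 2) * (r\<^sup>2) ^ k) \<le>
        (norm (S n) + 1 / (r - 1))\<^sup>2" for n
    proof -
      have "exp (- (pi\<^sup>2 / (4 * t))) *
          (triple_coeff (q\<^sup>2) n k * (q\<^sup>2) ^ (Suc k choose 2) * (r\<^sup>2) ^ k) \<le> (norm (P n))\<^sup>2"
        unfolding P_def r_def by (rule finite_product_lower_bound[OF t r(2) x(1)])
      also have "\<dots> \<le> (norm (S n) + 1 / (r - 1))\<^sup>2"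
        by (intro power_mono upper) auto
      finally show ?thesis .
    qed
    thus "\<exists>N. \<forall>n\<ge>N. exp (- (pi\<^sup>2 / (4 * t))) *
        (triple_coeff (q\<^sup>2) n k * (q\<^sup>2) ^ (Suc k choose 2) * (r\<^sup>2) ^ k) \<le>
        (norm (S n) + 1 / (r - 1))\<^sup>2" by blast
  qed
  with k have "1 / r < (1 / (r - 1))\<^sup>2" by simp
  hence "(r - 1)\<^sup>2 < r"
    using r by (simp add: power_divide field_simps)
  moreover have "5 * r \<le> r * r" using r by simp
  ultimately show False using r by (simp add: power2_eq_square algebra_simps)
qed

section \<open>No zeros in the closed unit disk\<close>

lemma partial_theta_nonzero_unit_disk:
  fixes x :: complex
  assumes q: "0 < q" "q < 1" and x: "norm x \<le> 1" "x \<noteq> 1"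
  shows "partial_theta q x \<noteq> 0"
proof
  assume zero: "partial_theta q x = 0"
  define a where "a j = q ^ (Suc j choose 2)" for j
  have e: "j * (j + 1) div 2 = Suc j choose 2" for j
    by (simp add: choose_two mult.commute)
  have mono: "a (Suc j) < a j" for j
    unfolding a_def Suc_choose_two[of "Suc j"] using q by (intro power_strict_decreasing) auto
  have "summable (\<lambda>j. complex_of_real (a j))"
    using summable_partial_theta[OF q, of 1] by (simp only: e a_def of_real_power) simp
  hence "a \<longlonglongrightarrow> 0"
    by (simp only: summable_complex_of_real) (rule summable_LIMSEQ_zero)
  hence d: "(\<lambda>j. a j - a (Suc j)) sums 1"
    using telescope_sums'[of a 0] by (simp add: a_def numeral_2_eq_2)
  have theta: "(\<lambda>j. a j * x ^ j) sums 0"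
    using summable_sums[OF summable_partial_theta[OF q, of x]] zero
    by (simp only: partial_theta_def e a_def of_real_power)
  \<comment> \<open>The removed term is \<open>a 0 = 1\<close>.\<close>
  have "(\<lambda>j. a (Suc j) * x ^ Suc j) sums (0 - 1)"
    using theta by (subst sums_Suc_iff) (simp add: a_def numeral_2_eq_2)
  from sums_diff[OF sums_mult[OF theta, of x] this]
  have "(\<lambda>j. (a j - a (Suc j)) * x ^ Suc j) sums 1"
    by (simp add: algebra_simps)
  \<comment> \<open>Two series of sum 1 are compared through real parts; their difference has
    nonnegative terms and sum 0, so each term vanishes. The term \<open>j = 0\<close> yields
    \<open>Re x = 1\<close>.\<close>
  from sums_diff[OF d sums_Re[OF this]]
  have s: "(\<lambda>j. (a j - a (Suc j)) * (1 - Re (x ^ Suc j))) sums 0"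
    by (simp add: algebra_simps del: power_Suc flip: of_real_diff)
  have "Re (x ^ Suc j) \<le> 1" for j
    using complex_Re_le_cmod[of "x ^ Suc j"] power_le_one[of "norm x" "Suc j"] x(1)
    by (simp add: norm_power del: power_Suc)
  hence "(a j - a (Suc j)) * (1 - Re (x ^ Suc j)) \<ge> 0" for j
    using mono[of j] by (intro mult_nonneg_nonneg) (auto simp del: power_Suc)
  from suminf_eq_zero_iff[OF sums_summable[OF s] this] sums_unique[OF s]
  have "(a 0 - a (Suc 0)) * (1 - Re (x ^ Suc 0)) = 0" by metis
  hence Re: "Re x = 1" using mono[of 0] by simp
  moreover have "(Re x)\<^sup>2 + (Im x)\<^sup>2 \<le> 1"
    using x(1) by (simp add: power_le_one flip: cmod_power2)
  ultimately have "Im x = 0" by simp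
  thus False using Re x(2) by (simp add: complex_eq_iff)
qed

theorem theorem1:
  fixes q :: real and x :: complex
  assumes "0 < q" and "q < 1"
    and "partial_theta q x = 0"
    and "x \<notin> \<real>"
    and "Re x \<ge> 0"
  shows "{x, cnj x} \<subseteq> half_annulus"
proof -
  have "x \<noteq> 1" using assms(4) by auto
  hence "1 < norm x"
    using partial_theta_nonzero_unit_disk[OF assms(1,2), of x] assms(3) by force
  moreover have "norm x < 5"
    using partial_theta_nonzero_outside[OF assms(1,2,5)] assms(3) by force
  \<comment> \<open>Conjugation preserves real part and modulus, so the bounds hold for
    \<open>cnj x\<close> as well.\<close>
  ultimately show ?thesis
    using assms(5) by (simp add: half_annulus_def)
qed

end
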